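(* Let $f:\mathbb{R}^n\to[0,\infty)$ be an even log-concave function, let $k\ge1$ be a real number, and let $K$ be a $p$-convex body in $\mathbb{R}^n$ for some $0<p\le1$. Then the body $L$ defined by the Minkowski functional $$\|x\|_L=\left[\int_0^{\|x\|_K^{-1}}f(rx)\,r^{k-1}\,dr\right]^{-\frac1k},\qquad x\in\mathbb{R}^n,$$ is $p$-convex, that is, $\|x+y\|_L^p\le\|x\|_L^p+\|y\|_L^p$ for all $x,y\in\mathbb{R}^n$.
   Context: A body is a compact set with nonempty interior. For a body $K\subset\mathbb{R}^n$ that is star-shaped with respect to the origin (in particular $0\in K$), its Minkowski functional is $\|x\|_K=\min\{\lambda\ge0:x\in\lambda K\}$, with value $+\infty$ if no such $\lambda$ exists. $K$ is not assumed symmetric, and the origin may lie on the boundary of $K$. For $p\in(0,1]$, such a body $K$ is $p$-convex if $\|x+y\|_K^p\le\|x\|_K^p+\|y\|_K^p$ for all $x,y\in\mathbb{R}^n$; equivalently, $t^{1/p}x+(1-t)^{1/p}y\in K$ whenever $x,y\in K$ and $t\in(0,1)$. A function $f:\mathbb{R}^n\to[0,\infty)$ is log-concave if $f(\lambda x+(1-\lambda)y)\ge f(x)^\lambda f(y)^{1-\lambda}$ for all $x,y\in\mathbb{R}^n$ and $\lambda\in(0,1)$; it is even if $f(-x)=f(x)$. Conventions: in the formula for $\|x\|_L$, $\|x\|_K^{-1}=0$ when $\|x\|_K=+\infty$, $0^{-1/k}=+\infty$, and $\|0\|_L=0$; the inequality for $\|\cdot\|_L$ is understood in $[0,\infty]$.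 *)

theory Defs
  imports "HOL-Analysis.Analysis"
begin

definition log_concave_fun :: "(real ^ 'n \<Rightarrow> real) \<Rightarrow> bool" where
  "log_concave_fun f \<longleftrightarrow> (\<forall>x. 0 \<le> f x) \<and>
     (\<forall>x y. \<forall>t\<in>{0<..<1}. f x powr t * f y powr (1 - t) \<le> f (t *\<^sub>R x + (1 - t) *\<^sub>R y))"

text \<open>Real powers on \<open>[0, \<infinity>]\<close>, with \<open>0\<close> to a negative power equal to \<open>\<infinity>\<close>.  The exponent
  \<open>0\<close> is never used below; its value there is inherited from \<^const>\<open>powr\<close>.\<close>

definition ennpowr :: "ennreal \<Rightarrow> real \<Rightarrow> ennreal" where
  "ennpowr a s =
     (if a = \<infinity> then (if s > 0 then \<infinity> else if s = 0 then 1 else 0)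
      else if a = 0 \<and> s < 0 then \<infinity>
      else ennreal (enn2real a powr s))"

definition star_shaped_origin :: "(real ^ 'n) set \<Rightarrow> bool" where
  "star_shaped_origin K \<longleftrightarrow> 0 \<in> K \<and> (\<forall>x\<in>K. closed_segment 0 x \<subseteq> K)"

text \<open>The infimum of the empty set is \<open>\<infinity>\<close>.  For compact \<open>K\<close> a finite infimum is
  a minimum, see \<open>minkowski_functional_attained\<close> below.\<close>

definition minkowski_functional :: "(real ^ 'n) set \<Rightarrow> real ^ 'n \<Rightarrow> ennreal" where
  "minkowski_functional K x = (INF l\<in>{l. 0 \<le> l \<and> x \<in> (\<lambda>y. l *\<^sub>R y) ` K}. ennreal l)"

definition p_subadditive :: "real \<Rightarrow> (real ^ 'n \<Rightarrow> ennreal) \<Rightarrow> bool" where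
  "p_subadditive p N \<longleftrightarrow> (\<forall>x y. ennpowr (N (x + y)) p \<le> ennpowr (N x) p + ennpowr (N y) p)"

definition p_convex_body :: "real \<Rightarrow> (real ^ 'n) set \<Rightarrow> bool" where
  "p_convex_body p K \<longleftrightarrow> compact K \<and> interior K \<noteq> {} \<and> star_shaped_origin K \<and>
     p_subadditive p (minkowski_functional K)"

text \<open>In \<^typ>\<open>ennreal\<close> we have \<open>inverse 0 = \<infinity>\<close> and \<open>inverse \<infinity> = 0\<close>, so the domain of integration
  is \<open>{0<..}\<close> if the functional of \<open>K\<close> vanishes at \<open>x\<close>, and empty if it is infinite.
  Although \<open>f\<close> need not be Borel, \<open>r \<mapsto> f (r x)\<close> is log-concave on the line and hence Borel.\<close>

definition L_functional ::
    "(real ^ 'n \<Rightarrow> real) \<Rightarrow> real \<Rightarrow> (real ^ 'n) set \<Rightarrow> real ^ 'n \<Rightarrow> ennreal" where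
  "L_functional f k K x =
     (if x = 0 then 0
      else ennpowr
        (\<integral>\<^sup>+r\<in>{r. 0 < r \<and> ennreal r \<le> inverse (minkowski_functional K x)}.
            ennreal (f (r *\<^sub>R x) * r powr (k - 1)) \<partial>lborel)
        (- (1 / k)))"

lemma minkowski_functional_attained:
  fixes K :: "(real ^ 'n) set"
  assumes K: "compact K"
    and ne: "minkowski_functional K x \<noteq> \<infinity>"
  shows "\<exists>l\<ge>0. x \<in> (\<lambda>y. l *\<^sub>R y) ` K \<and> minkowski_functional K x = ennreal l \<and>
           (\<forall>m\<ge>0. x \<in> (\<lambda>y. m *\<^sub>R y) ` K \<longrightarrow> l \<le> m)"
proof -
  define S where "S = {l::real. 0 \<le> l \<and> x \<in> (\<lambda>y. l *\<^sub>R y) ` K}"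
  have S_eq: "S = {0..} \<inter> {l. \<exists>y\<in>K. x - l *\<^sub>R y = 0}"
    by (auto simp: S_def image_iff)
  have "S \<noteq> {}"
  proof
    assume "S = {}"
    then have "minkowski_functional K x = top"
      unfolding minkowski_functional_def S_def[symmetric] by simp
    with ne show False by simp
  qed
  then obtain l0 where l0: "l0 \<in> S" by auto
  have cl: "compact (({0..l0} \<times> K) \<inter> (\<lambda>(l,y). (x - l *\<^sub>R y)) -` {0})"
  proof -
    have c: "compact ({0..l0} \<times> K)" using K by (intro compact_Times) auto
    have "closed (({0..l0} \<times> K) \<inter> (\<lambda>(l,y). (x - l *\<^sub>R y)) -` {0})"
      by (intro continuous_closed_preimage compact_imp_closed c)
         (auto simp: case_prod_unfold intro!: continuous_intros)
    with c show ?thesis using compact_Int_closed[OF c]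
      by (metis Int_assoc Int_absorb)
  qed
  define A where "A = fst ` (({0..l0} \<times> K) \<inter> (\<lambda>(l,y). (x - l *\<^sub>R y)) -` {0})"
  have "compact A" unfolding A_def
    by (rule compact_continuous_image[OF _ cl]) (intro continuous_intros)
  moreover have A: "A = S \<inter> {..l0}"
    unfolding A_def S_eq by (force simp: image_iff)
  moreover have "A \<noteq> {}" using l0 A by auto
  ultimately obtain l where l: "l \<in> A" "\<And>m. m \<in> A \<Longrightarrow> l \<le> m"
    using compact_attains_inf by metis
  have min: "l \<le> m" if "m \<in> S" for m
    using l that A l0 by (cases "m \<le> l0") force+
  have lS: "l \<in> S" using l A by auto
  have "minkowski_functional K x = ennreal l"
    unfolding minkowski_functional_def S_def[symmetric]
    using lS min by (intro antisym INF_lower INF_greatest) (auto simp: ennreal_leI)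
  then show ?thesis using lS min by (auto simp: S_def)
qed

end

theory Submission
  imports Defs
begin

text \<open>
  The proof is a transport argument along the rays through \<open>x\<close>, \<open>y\<close> and \<open>x + y\<close>.  Let \<open>A\<close> and \<open>B\<close> be
  the integrals defining the functional of \<open>L\<close> at \<open>x\<close> and \<open>y\<close>, and let \<open>r = r(q)\<close> and \<open>s = s(q)\<close>, for
  \<open>0 < q < 1\<close>, be the quantiles of the densities \<open>f (r x) r^(k-1) / A\<close> and \<open>f (s y) s^(k-1) / B\<close>.
  Define \<open>t\<close> by \<open>t^(-p) = r^(-p) + s^(-p)\<close>.  The weights \<open>l = (t/r)^p\<close> and \<open>m = (t/s)^p\<close> sum to \<open>1\<close>, and
  \<open>t (x + y) = (t/r) (r x) + (t/s) (s y)\<close> with \<open>t/r \<le> l\<close> and \<open>t/s \<le> m\<close>.  As an even log-concave function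
  decreases along rays, \<open>f (t (x + y)) \<ge> f (r x)^l f (s y)^m\<close>, while \<open>p\<close>-convexity of \<open>K\<close> keeps \<open>t\<close> in
  the domain of integration for \<open>x + y\<close>.  Differentiating \<open>t\<close> in \<open>q\<close> and applying the weighted AM-GM
  inequality twice gives \<open>f (t (x + y)) t^(k-1) t' \<ge> (A^(-p/k) + B^(-p/k))^(-k/p)\<close>, which is integrated
  over \<open>0 < q < 1\<close>.
\<close>

section \<open>Weighted AM-GM and the harmonic combination of two radii\<close>

text \<open>AM-GM is used twice. With \<open>a = A powr (-1/q)\<close> and
  \<open>b = B powr (-1/q)\<close>, the mean of \<open>a / l\<close> and \<open>b / m\<close> with
  weights \<open>l\<close>, \<open>m\<close> is exactly \<open>a + b\<close>, and the power
  \<open>-q\<close> reverses the inequality. The factors \<open>u\<close>, \<open>v\<close> are then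
  inserted so that they cancel in the geometric mean, and the second use bounds what
  remains.\<close>

lemma weighted_AM_GM_harmonic:
  fixes A B u v l m q :: real
  assumes "0 < A" "0 < B" "0 < u" "0 < v" "0 < l" "0 < m" "l + m = 1" "0 < q"
  shows "(A powr (-1/q) + B powr (-1/q)) powr (-q)
         \<le> u powr l * v powr m * (l * (A * l powr q / u) + m * (B * m powr q / v))"
proof -
  define a where "a = A powr (-1/q)"
  define b where "b = B powr (-1/q)"
  have ab: "0 < a" "0 < b" using assms by (auto simp: a_def b_def)
  have A: "(a / l) powr (-q) = A * l powr q" and B: "(b / m) powr (-q) = B * m powr q"
    using assms by (simp_all add: a_def b_def powr_divide powr_powr) (simp_all add: powr_minus field_simps)
  have "(a / l) powr l * (b / m) powr m \<le> l * (a / l) + m * (b / m)"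
    using assms ab by (intro Youngs_inequality_0) auto
  also have "\<dots> = a + b" using assms by simp
  finally have "(a + b) powr (-q) \<le> ((a / l) powr l * (b / m) powr m) powr (-q)"
    using assms ab by (intro powr_mono2') auto
  also have "\<dots> = ((a / l) powr (-q)) powr l * ((b / m) powr (-q)) powr m"
    using assms ab by (simp add: powr_mult powr_powr mult.commute)
  also have "\<dots> = (A * l powr q) powr l * (B * m powr q) powr m"
    unfolding A B ..
  also have "\<dots> = u powr l * v powr m * ((A * l powr q / u) powr l * (B * m powr q / v) powr m)"
    using assms by (simp add: powr_divide)
  also have "\<dots> \<le> u powr l * v powr m * (l * (A * l powr q / u) + m * (B * m powr q / v))"
    using assms by (intro mult_left_mono Youngs_inequality_0) auto
  finally show ?thesis by (simp add: a_def b_def)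
qed

text \<open>If \<open>r\<close> and \<open>s\<close> are reciprocals of positive gauge values
  \<open>a\<close> and \<open>b\<close>, this is the reciprocal of
  \<open>(a powr p + b powr p) powr (1/p)\<close>, the bound that \<open>p\<close>-subadditivity
  gives for a sum. For \<open>p = 1\<close> it is half the harmonic mean.\<close>

definition pharm :: "real \<Rightarrow> real \<Rightarrow> real \<Rightarrow> real" where
  "pharm p r s = (r powr (-p) + s powr (-p)) powr (-1/p)"

lemma pharm_pos: "0 < r \<Longrightarrow> 0 < pharm p r s"
  using add_pos_nonneg[of "r powr (-p)" "s powr (-p)"] by (simp add: pharm_def)

lemma pharm_powr_minus:
  assumes "0 < p" "0 < r"
  shows "pharm p r s powr (-p) = r powr (-p) + s powr (-p)"
proof -
  have "0 < r powr (-p) + s powr (-p)" using assms by (intro add_pos_nonneg) auto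
  then show ?thesis using assms by (simp add: pharm_def powr_powr)
qed

lemma pharm_weights:
  assumes "0 < p" "0 < r" "0 < s"
  shows "(pharm p r s / r) powr p + (pharm p r s / s) powr p = 1"
proof -
  have t: "0 < pharm p r s" using pharm_pos assms by blast
  have "(pharm p r s / r) powr p + (pharm p r s / s) powr p
      = pharm p r s powr p * (r powr (-p) + s powr (-p))"
    using assms t by (simp add: powr_divide powr_minus field_simps)
  also have "\<dots> = pharm p r s powr p * pharm p r s powr (-p)"
    using assms by (simp add: pharm_powr_minus)
  also have "\<dots> = 1" using t by (simp flip: powr_add)
  finally show ?thesis .
qed

text \<open>The form is that of implicit differentiation of
  \<open>t powr (-p) = r powr (-p) + s powr (-p)\<close>; the outer exponent \<open>-1/p - 1\<close>
  of the explicit formula turns into \<open>t powr (p + 1)\<close>.\<close>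

lemma pharm_has_real_derivative:
  assumes "0 < p" "0 < \<rho> x" "0 < \<sigma> x"
    and "(\<rho> has_real_derivative \<rho>') (at x)" "(\<sigma> has_real_derivative \<sigma>') (at x)"
  shows "((\<lambda>x. pharm p (\<rho> x) (\<sigma> x)) has_real_derivative
     pharm p (\<rho> x) (\<sigma> x) powr (p + 1) * (\<rho> x powr (-p-1) * \<rho>' + \<sigma> x powr (-p-1) * \<sigma>')) (at x)"
proof -
  have pos: "0 < \<rho> x powr (-p) + \<sigma> x powr (-p)" using assms by (intro add_pos_nonneg) auto
  have e: "(\<rho> x powr (-p) + \<sigma> x powr (-p)) powr (-1/p - 1) = pharm p (\<rho> x) (\<sigma> x) powr (p + 1)"
  proof -
    have "-1/p * (p + 1) = -1/p - 1" using assms(1) by (simp add: field_simps)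
    then show ?thesis by (simp add: pharm_def powr_powr)
  qed
  have d: "((\<lambda>x. g x powr a) has_real_derivative a * g x powr (a - 1) * g') (at x)"
    if "(g has_real_derivative g') (at x)" "0 < g x" for g g' a
    using DERIV_fun_powr[OF that, of a] by simp
  have "((\<lambda>x. pharm p (\<rho> x) (\<sigma> x)) has_real_derivative
      -1/p * (\<rho> x powr (-p) + \<sigma> x powr (-p)) powr (-1/p - 1) *
      (-p * \<rho> x powr (-p-1) * \<rho>' + -p * \<sigma> x powr (-p-1) * \<sigma>')) (at x)"
    unfolding pharm_def using assms pos by (intro d DERIV_add)
  also have "-1/p * (\<rho> x powr (-p) + \<sigma> x powr (-p)) powr (-1/p - 1) *
      (-p * \<rho> x powr (-p-1) * \<rho>' + -p * \<sigma> x powr (-p-1) * \<sigma>')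
    = pharm p (\<rho> x) (\<sigma> x) powr (p + 1) * (\<rho> x powr (-p-1) * \<rho>' + \<sigma> x powr (-p-1) * \<sigma>')"
    unfolding e using assms(1) by (simp add: field_simps)
  finally show ?thesis .
qed

text \<open>The quotients \<open>A / (u * r powr (k - 1))\<close> and
  \<open>B / (v * s powr (k - 1))\<close> are the speeds of the two quantiles, so the last factor is
  the derivative of \<open>t\<close>. The lower bound depends on \<open>A\<close> and
  \<open>B\<close> alone; it is weighted AM-GM with \<open>q = k/p\<close>.\<close>

lemma transport_density_bound:
  assumes "0 < p" "0 < k" "0 < A" "0 < B" "0 < u" "0 < v" "0 < r" "0 < s"
  defines "t \<equiv> pharm p r s"
  shows "(A powr (-p/k) + B powr (-p/k)) powr (-k/p)
    \<le> u powr ((t / r) powr p) * v powr ((t / s) powr p) * t powr (k - 1) *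
       (t powr (p + 1) * (r powr (-p-1) * (A / (u * r powr (k - 1)))
                        + s powr (-p-1) * (B / (v * s powr (k - 1)))))"
proof -
  define l where "l = (t / r) powr p"
  define m where "m = (t / s) powr p"
  have t: "0 < t" using pharm_pos assms by blast
  have lm: "0 < l" "0 < m" "l + m = 1"
    using t assms pharm_weights[of p r s] by (auto simp: l_def m_def)
  \<comment> \<open>All powers of \<open>t\<close> and \<open>x\<close> collect into
    \<open>(t / x) powr (k + p)\<close>, which is the weight \<open>(t / x) powr p\<close> times its
    own power \<open>k/p\<close>.\<close>
  have *: "t powr (k - 1) * (t powr (p + 1) * (x powr (-p-1) * (C / (c * x powr (k - 1)))))
     = (t / x) powr p * (C * ((t / x) powr p) powr (k/p) / c)" if "0 < x" for x c C
  proof -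
    have "t powr (k - 1) * (t powr (p + 1) * (x powr (-p-1) * (C / (c * x powr (k - 1)))))
      = (t powr (k - 1) * t powr (p + 1)) * (x powr (-p-1) / x powr (k - 1)) * (C / c)"
      by (simp add: field_simps)
    also have "x powr (-p-1) / x powr (k - 1) = x powr (-(k + p))"
      using powr_diff[of x "-p-1" "k - 1"] by (simp add: add.commute)
    also have "t powr (k - 1) * t powr (p + 1) = t powr (k + p)"
      by (simp flip: powr_add)
    also have "t powr (k + p) * x powr (-(k + p)) * (C / c) = (t / x) powr (k + p) * (C / c)"
      unfolding powr_minus using t that by (simp add: powr_divide field_simps)
    also have "\<dots> = (t / x) powr p * (C * ((t / x) powr p) powr (k/p) / c)"
      using assms by (simp add: powr_add powr_powr mult.commute)
    finally show ?thesis .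
  qed
  have "(A powr (-p/k) + B powr (-p/k)) powr (-k/p)
     \<le> u powr l * v powr m * (l * (A * l powr (k/p) / u) + m * (B * m powr (k/p) / v))"
    using weighted_AM_GM_harmonic[of A B u v l m "k/p"] assms lm by simp
  also have "l * (A * l powr (k/p) / u) + m * (B * m powr (k/p) / v)
    = t powr (k - 1) * (t powr (p + 1) * (r powr (-p-1) * (A / (u * r powr (k - 1)))
                        + s powr (-p-1) * (B / (v * s powr (k - 1)))))"
    using *[of r A u] *[of s B v] assms by (simp add: l_def m_def distrib_left)
  finally show ?thesis by (simp add: l_def m_def mult.assoc)
qed

section \<open>Quantiles and transport on the half-line\<close>

text \<open>The indefinite integral \<open>F\<close> increases strictly from \<open>0\<close> to
  \<open>A\<close>, and \<open>\<rho>\<close> inverts \<open>F / A\<close>, whence its derivative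
  \<open>A / h\<close>. Continuity of \<open>h\<close> is asked only in the open interval: a
  log-concave density may jump at the end of its support, and \<open>0 powr 0 = 0\<close> may cause
  a jump at the origin.\<close>

lemma quantile_function:
  fixes h :: "real \<Rightarrow> real"
  assumes R: "0 < R" and int: "h integrable_on {0..R}" and cont: "continuous_on {0<..<R} h"
    and pos: "\<And>x. 0 < x \<Longrightarrow> x < R \<Longrightarrow> 0 < h x"
  obtains \<rho> where "0 < integral {0..R} h"
    "\<And>m. m \<in> {0<..<1} \<Longrightarrow> 0 < \<rho> m \<and> \<rho> m < R \<and>
       (\<rho> has_real_derivative integral {0..R} h / h (\<rho> m)) (at m)"
proof -
  define F where "F x = integral {0..x} h" for x
  define A where "A = F R"
  have contF: "continuous_on {0..R} F"
    unfolding F_def by (rule indefinite_integral_continuous_1[OF int])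
  have derF: "(F has_real_derivative h x) (at x)" if "0 < x" "x < R" for x
  proof -
    have "isCont h x"
      using cont that by (simp add: continuous_on_eq_continuous_at)
    \<comment> \<open>The removed set is the finite exceptional set of the rule for indefinite
      integrals, here empty.\<close>
    then have "continuous (at x within ({0..R} - {})) h"
      by (simp add: continuous_at_imp_continuous_at_within)
    then have "(F has_vector_derivative h x) (at x within ({0..R} - {}))"
      unfolding F_def using that by (intro integral_has_vector_derivative_continuous_at[OF int]) auto
    moreover have "at x within ({0..R} - {}) = at x"
      using that by (simp add: at_within_Icc_at)
    ultimately show ?thesis
      by (simp add: has_real_derivative_iff_has_vector_derivative)
  qed
  have mono: "F x < F y" if "0 \<le> x" "x < y" "y \<le> R" for x y
  proof (rule DERIV_pos_imp_increasing_open[OF that(2)])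
    show "\<exists>d. (F has_real_derivative d) (at z) \<and> 0 < d" if "x < z" "z < y" for z
      using derF[of z] pos[of z] that \<open>0 \<le> x\<close> \<open>y \<le> R\<close> by auto
    show "continuous_on {x..y} F"
      using contF that by (auto intro: continuous_on_subset)
  qed
  have F0: "F 0 = 0" by (simp add: F_def)
  have A: "0 < A" using mono[of 0 R] R F0 by (simp add: A_def)
  have "\<exists>x. 0 < x \<and> x < R \<and> F x = m * A" if "0 < m" "m < 1" for m
  proof -
    have "\<exists>x\<ge>0. x \<le> R \<and> F x = m * A"
      using A that R contF F0 by (intro IVT') (auto simp: A_def)
    then obtain x where x: "0 \<le> x" "x \<le> R" "F x = m * A" by blast
    have "x \<noteq> 0" "x \<noteq> R" using x(3) F0 A that by (auto simp: A_def)
    with x show ?thesis by (intro exI[of _ x]) auto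
  qed
  then have "\<forall>m. \<exists>x. 0 < m \<and> m < 1 \<longrightarrow> 0 < x \<and> x < R \<and> F x = m * A"
    by blast
  from choice[OF this] obtain \<rho> where
    \<rho>: "\<And>m. 0 < m \<Longrightarrow> m < 1 \<Longrightarrow> 0 < \<rho> m \<and> \<rho> m < R \<and> F (\<rho> m) = m * A"
    by blast
  \<comment> \<open>\<open>\<rho>\<close> was chosen only as a right inverse of
    \<open>F / A\<close>; strict monotonicity makes it a left inverse, which the continuity of
    \<open>\<rho>\<close> rests on.\<close>
  have inv: "\<rho> (F x / A) = x" if "0 < x" "x < R" for x
  proof -
    have "0 < F x" "F x < A" using mono[of 0 x] mono[of x R] that F0 by (auto simp: A_def)
    then have "0 < F x / A" "F x / A < 1" using A by auto
    from \<rho>[OF this] have 1: "0 < \<rho> (F x / A)" "\<rho> (F x / A) < R" "F (\<rho> (F x / A)) = F x"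
      using A by auto
    then show ?thesis
      using mono[of x "\<rho> (F x / A)"] mono[of "\<rho> (F x / A)" x] that by linarith
  qed
  have "(\<rho> has_real_derivative A / h (\<rho> m)) (at m)" if m: "0 < m" "m < 1" for m
  proof -
    note r = \<rho>[OF m]
    obtain a b where ab: "0 < a" "a < \<rho> m" "\<rho> m < b" "b < R"
      using r dense by meson
    have dG: "((\<lambda>x. F x / A) has_real_derivative h (\<rho> m) / A) (at (\<rho> m))"
      using derF r by (intro DERIV_cdivide) auto
    have "isCont \<rho> (F (\<rho> m) / A)"
    proof (rule isCont_inverse_function2[where f = "\<lambda>x. F x / A"])
      show "a < \<rho> m" "\<rho> m < b" by fact+
      show "\<rho> (F z / A) = z" if "a \<le> z" "z \<le> b" for z using inv ab that by simp
      show "isCont (\<lambda>x. F x / A) z" if "a \<le> z" "z \<le> b" for z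
        using derF[of z] ab that A by (intro continuous_divide DERIV_isCont[OF derF]) auto
    qed
    then have "isCont \<rho> m" using r A by simp
    then have "(\<rho> has_real_derivative inverse (h (\<rho> m) / A)) (at m)"
      using dG pos[of "\<rho> m"] r A \<rho> m
      by (intro DERIV_inverse_function[where f = "\<lambda>x. F x / A" and a = 0 and b = 1]) auto
    then show ?thesis by simp
  qed
  then show ?thesis
    using that[of \<rho>] \<rho> A unfolding A_def F_def by auto
qed

text \<open>An inequality of Prekopa-Leindler type whose weights vary with the two points.
  \<open>T\<close> combines points of equal quantile, and along it \<open>W (T m) * T' m\<close> is
  at least a constant, so the change of variables \<open>t = T m\<close> bounds the integral of
  \<open>W\<close>.\<close>

lemma integral_pharm_transport:
  fixes u v w :: "real \<Rightarrow> real"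
  assumes p: "0 < p" and k: "0 < k" and RS: "0 < R" "0 < S"
    and cu: "continuous_on {0<..<R} u" and cv: "continuous_on {0<..<S} v"
    and pu: "\<And>r. 0 < r \<Longrightarrow> r < R \<Longrightarrow> 0 < u r" and pv: "\<And>s. 0 < s \<Longrightarrow> s < S \<Longrightarrow> 0 < v s"
    and iu: "(\<lambda>r. u r * r powr (k - 1)) integrable_on {0..R}"
    and iv: "(\<lambda>s. v s * s powr (k - 1)) integrable_on {0..S}"
    and mw: "w \<in> borel_measurable borel"
    and w: "\<And>r s. 0 < r \<Longrightarrow> r < R \<Longrightarrow> 0 < s \<Longrightarrow> s < S \<Longrightarrow>
      u r powr ((pharm p r s / r) powr p) * v s powr ((pharm p r s / s) powr p) \<le> w (pharm p r s)"
  defines "A \<equiv> integral {0..R} (\<lambda>r. u r * r powr (k - 1))"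
    and "B \<equiv> integral {0..S} (\<lambda>s. v s * s powr (k - 1))"
  shows "0 < A" "0 < B"
    "ennreal ((A powr (-p/k) + B powr (-p/k)) powr (-k/p))
       \<le> (\<integral>\<^sup>+t\<in>{0<..}. ennreal (w t * t powr (k - 1)) \<partial>lborel)"
proof -
  have "continuous_on {0<..<R} (\<lambda>r. u r * r powr (k - 1))"
    by (intro continuous_intros cu) auto
  from quantile_function[OF RS(1) iu this] pu obtain \<rho> where A: "0 < A"
    and \<rho>: "\<And>m. m \<in> {0<..<1} \<Longrightarrow> 0 < \<rho> m \<and> \<rho> m < R \<and>
       (\<rho> has_real_derivative A / (u (\<rho> m) * \<rho> m powr (k - 1))) (at m)"
    unfolding A_def by auto
  have "continuous_on {0<..<S} (\<lambda>s. v s * s powr (k - 1))"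
    by (intro continuous_intros cv) auto
  from quantile_function[OF RS(2) iv this] pv obtain \<sigma> where B: "0 < B"
    and \<sigma>: "\<And>m. m \<in> {0<..<1} \<Longrightarrow> 0 < \<sigma> m \<and> \<sigma> m < S \<and>
       (\<sigma> has_real_derivative B / (v (\<sigma> m) * \<sigma> m powr (k - 1))) (at m)"
    unfolding B_def by auto
  show "0 < A" "0 < B" by fact+
  define c where "c = (A powr (-p/k) + B powr (-p/k)) powr (-k/p)"
  define W where "W t = w t * t powr (k - 1)" for t
  define T where "T m = pharm p (\<rho> m) (\<sigma> m)" for m
  define T' where "T' m = T m powr (p + 1) *
    (\<rho> m powr (-p-1) * (A / (u (\<rho> m) * \<rho> m powr (k - 1)))
     + \<sigma> m powr (-p-1) * (B / (v (\<sigma> m) * \<sigma> m powr (k - 1))))" for m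
  have derT: "(T has_real_derivative T' m) (at m)" if "m \<in> {0<..<1}" for m
    unfolding T_def[abs_def] T'_def using \<rho>[OF that] \<sigma>[OF that] p
    by (intro pharm_has_real_derivative) auto
  have Tpos: "0 < T m" if "m \<in> {0<..<1}" for m
    unfolding T_def using \<rho>[OF that] by (intro pharm_pos) auto
  have T'nn: "0 \<le> T' m" if "m \<in> {0<..<1}" for m
    unfolding T'_def using \<rho>[OF that] \<sigma>[OF that] A B pu[of "\<rho> m"] pv[of "\<sigma> m"]
    by (intro mult_nonneg_nonneg add_nonneg_nonneg divide_nonneg_nonneg) auto
  have bound: "c \<le> W (T m) * T' m" if "m \<in> {0<..<1}" for m
  proof -
    note r = \<rho>[OF that] and s = \<sigma>[OF that]
    let ?l = "(T m / \<rho> m) powr p" and ?m = "(T m / \<sigma> m) powr p"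
    have "c \<le> u (\<rho> m) powr ?l * v (\<sigma> m) powr ?m * T m powr (k - 1) * T' m"
      unfolding c_def T'_def T_def using r s A B p k pu[of "\<rho> m"] pv[of "\<sigma> m"]
      by (intro transport_density_bound) auto
    also have "\<dots> \<le> w (T m) * T m powr (k - 1) * T' m"
      using w[of "\<rho> m" "\<sigma> m"] r s T'nn[OF that]
      by (intro mult_right_mono) (auto simp: T_def)
    finally show ?thesis by (simp add: W_def)
  qed
  have contT': "continuous_on {0<..<1} T'"
  proof -
    have c\<rho>: "continuous_on {0<..<1} \<rho>" and c\<sigma>: "continuous_on {0<..<1} \<sigma>"
      and cT: "continuous_on {0<..<1} T"
      using \<rho> \<sigma> derT by (meson DERIV_isCont continuous_at_imp_continuous_on)+
    have "continuous_on {0<..<1} (\<lambda>m. u (\<rho> m))" "continuous_on {0<..<1} (\<lambda>m. v (\<sigma> m))"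
      using \<rho> \<sigma> by (auto intro!: continuous_on_compose2[OF cu c\<rho>] continuous_on_compose2[OF cv c\<sigma>])
    moreover have "\<rho> m \<noteq> 0" "\<sigma> m \<noteq> 0" "T m \<noteq> 0" "u (\<rho> m) \<noteq> 0" "v (\<sigma> m) \<noteq> 0"
      if "m \<in> {0<..<1}" for m
      using \<rho>[OF that] \<sigma>[OF that] pu[of "\<rho> m"] pv[of "\<sigma> m"] Tpos[OF that] by auto
    ultimately show ?thesis
      unfolding T'_def[abs_def] using c\<rho> c\<sigma> cT by (intro continuous_intros) auto
  qed
  have mW [measurable]: "W \<in> borel_measurable borel"
    unfolding W_def[abs_def] using mw by measurable
  let ?I = "\<integral>\<^sup>+t\<in>{0<..}. ennreal (W t) \<partial>lborel"
  \<comment> \<open>The substitution rule needs a compact interval with a continuous derivative, but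
    \<open>T\<close> is controlled only on the open unit interval, hence the cut to
    \<open>{a..b}\<close>.\<close>
  have sub: "ennreal (c * (b - a)) \<le> ?I" if ab: "0 < a" "a < b" "b < 1" for a b
  proof -
    have sb: "{a..b} \<subseteq> {0<..<1}" using ab by auto
    have "ennreal (c * (b - a)) = (\<integral>\<^sup>+m. ennreal c * indicator {a..b} m \<partial>lborel)"
      using ab by (simp add: nn_integral_cmult_indicator ennreal_mult' c_def)
    also have "\<dots> \<le> (\<integral>\<^sup>+m. W (T m) * T' m * indicator {a..b} m \<partial>lborel)"
      using bound sb by (intro nn_integral_mono) (auto split: split_indicator intro!: ennreal_leI)
    also have "\<dots> = (\<integral>\<^sup>+t. W t * indicator {T a..T b} t \<partial>lborel)"
    proof (rule nn_integral_substitution[symmetric])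
      show "set_borel_measurable borel {T a..T b} W"
        unfolding set_borel_measurable_def by measurable
      show "continuous_on {a..b} T'" by (rule continuous_on_subset[OF contT' sb])
    qed (use derT T'nn sb ab in auto)
    also have "\<dots> \<le> ?I"
      using Tpos[of a] ab by (intro nn_integral_mono) (auto split: split_indicator)
    finally show ?thesis .
  qed
  \<comment> \<open>Exhausting the unit interval by \<open>{e..1 - e}\<close> recovers the full
    constant \<open>c\<close>.\<close>
  have "((\<lambda>e. ennreal (c * ((1 - e) - e))) \<longlongrightarrow> ennreal (c * ((1 - 0) - 0))) (at_right 0)"
    by (intro tendsto_intros)
  moreover have "eventually (\<lambda>e. ennreal (c * ((1 - e) - e)) \<le> ?I) (at_right 0)"
    using eventually_at_right_real[of 0 "1/2 :: real", simplified]
  proof (rule eventually_mono)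
    show "ennreal (c * ((1 - e) - e)) \<le> ?I" if "0 < e \<and> e * 2 < 1" for e
      using sub[of e "1 - e"] that by simp
  qed
  ultimately have "ennreal (c * ((1 - 0) - 0)) \<le> ?I"
    by (rule tendsto_upperbound) simp
  then show "ennreal ((A powr (-p/k) + B powr (-p/k)) powr (-k/p))
       \<le> (\<integral>\<^sup>+t\<in>{0<..}. ennreal (w t * t powr (k - 1)) \<partial>lborel)"
    by (simp add: c_def W_def)
qed

section \<open>Even log-concave functions on rays\<close>

lemma powr_le_cancel2:
  fixes x y a :: real
  assumes "0 < a" "0 \<le> y" "x powr a \<le> y powr a"
  shows "x \<le> y"
  using powr_less_mono2[of a y x] assms by linarith

lemma log_concave_fun_nonneg: "log_concave_fun f \<Longrightarrow> 0 \<le> f x"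
  by (simp add: log_concave_fun_def)

lemma log_concave_funD:
  assumes "log_concave_fun f" "0 < l" "0 < m" "l + m = 1"
  shows "f x powr l * f y powr m \<le> f (l *\<^sub>R x + m *\<^sub>R y)"
proof -
  have m: "m = 1 - l" and "l \<in> {0<..<1}" using assms by auto
  then show ?thesis using assms(1) unfolding m log_concave_fun_def by blast
qed

text \<open>The point \<open>c *\<^sub>R x\<close> is the convex combination of \<open>x\<close> and
  \<open>- x\<close> with weights \<open>(1 + c) / 2\<close> and \<open>(1 - c) / 2\<close>, and
  \<open>f\<close> takes the same value at both. For \<open>c = 1\<close> the second weight
  vanishes, so that case is separate.\<close>

lemma even_log_concave_le_scaleR:
  assumes lc: "log_concave_fun f" and even: "\<And>x. f (- x) = f x" and c: "0 \<le> c" "c \<le> 1"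
  shows "f x \<le> f (c *\<^sub>R x)"
proof (cases "c = 1")
  case False
  have "f x powr ((1 + c) / 2) * f (- x) powr ((1 - c) / 2)
      \<le> f (((1 + c) / 2) *\<^sub>R x + ((1 - c) / 2) *\<^sub>R (- x))"
    using c False by (intro log_concave_funD[OF lc]) (auto simp: field_simps)
  also have "((1 + c) / 2) *\<^sub>R x + ((1 - c) / 2) *\<^sub>R (- x) = c *\<^sub>R x"
    by (simp flip: scaleR_left_diff_distrib) (simp add: field_simps)
  also have "f x powr ((1 + c) / 2) * f (- x) powr ((1 - c) / 2) = f x"
    using log_concave_fun_nonneg[OF lc, of x]
    by (simp add: even flip: powr_add) (simp add: field_simps)
  finally show ?thesis .
qed simp

lemma even_log_concave_ray_antimono:
  assumes "log_concave_fun f" "\<And>x. f (- x) = f x" "0 \<le> s" "s \<le> r"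
  shows "f (r *\<^sub>R x) \<le> f (s *\<^sub>R x)"
proof (cases "r = 0")
  case False
  then show ?thesis
    using even_log_concave_le_scaleR[OF assms(1,2), of "s / r" "r *\<^sub>R x"] assms by simp
qed (use assms in simp)

text \<open>Shrinking \<open>x\<close> by \<open>a / l\<close> and \<open>y\<close> by
  \<open>b / m\<close> can only increase \<open>f\<close>; log-concavity with the true weights
  \<open>l\<close>, \<open>m\<close> does the rest.\<close>

lemma even_log_concave_subconvex:
  assumes lc: "log_concave_fun f" and even: "\<And>x. f (- x) = f x"
    and lm: "0 < l" "0 < m" "l + m = 1" and ab: "0 \<le> a" "a \<le> l" "0 \<le> b" "b \<le> m"
  shows "f x powr l * f y powr m \<le> f (a *\<^sub>R x + b *\<^sub>R y)"
proof -
  have "f x powr l * f y powr m \<le> f ((a / l) *\<^sub>R x) powr l * f ((b / m) *\<^sub>R y) powr m"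
    using lm ab lc
    by (intro mult_mono powr_mono2 even_log_concave_le_scaleR[OF lc even])
       (auto simp: log_concave_fun_nonneg)
  also have "\<dots> \<le> f (l *\<^sub>R (a / l) *\<^sub>R x + m *\<^sub>R (b / m) *\<^sub>R y)"
    using lm by (intro log_concave_funD[OF lc])
  also have "l *\<^sub>R (a / l) *\<^sub>R x + m *\<^sub>R (b / m) *\<^sub>R y = a *\<^sub>R x + b *\<^sub>R y"
    using lm by simp
  finally show ?thesis .
qed

text \<open>Where \<open>f\<close> is positive, \<open>- ln f\<close> is convex along the line, and
  a convex function on an open interval is continuous.\<close>

lemma log_concave_ray_continuous_on:
  assumes lc: "log_concave_fun f" and pos: "\<And>r. a < r \<Longrightarrow> r < b \<Longrightarrow> 0 < f (r *\<^sub>R x)"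
  shows "continuous_on {a<..<b} (\<lambda>r. f (r *\<^sub>R x))"
proof -
  have "convex_on {a<..<b} (\<lambda>r. - ln (f (r *\<^sub>R x)))"
  proof (rule convex_onI)
    fix t r s :: real
    assume t: "0 < t" "t < 1" and rs: "r \<in> {a<..<b}" "s \<in> {a<..<b}"
    define q where "q = (1 - t) *\<^sub>R r + t *\<^sub>R s"
    have "q \<in> {a<..<b}"
      unfolding q_def using convexD[of "{a<..<b}" r s "1 - t" t] t rs by auto
    then have p: "0 < f (r *\<^sub>R x)" "0 < f (s *\<^sub>R x)" "0 < f (q *\<^sub>R x)"
      using pos rs by auto
    have "f (r *\<^sub>R x) powr (1 - t) * f (s *\<^sub>R x) powr t \<le> f (q *\<^sub>R x)"
      using log_concave_funD[OF lc, of "1 - t" t "r *\<^sub>R x" "s *\<^sub>R x"] t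
      by (simp add: q_def scaleR_left_distrib)
    then have "ln (f (r *\<^sub>R x) powr (1 - t) * f (s *\<^sub>R x) powr t) \<le> ln (f (q *\<^sub>R x))"
      using p by (subst ln_le_cancel_iff) auto
    then show "- ln (f (((1 - t) *\<^sub>R r + t *\<^sub>R s) *\<^sub>R x))
        \<le> (1 - t) * - ln (f (r *\<^sub>R x)) + t * - ln (f (s *\<^sub>R x))"
      using p by (simp add: ln_mult ln_powr q_def)
  qed auto
  then have "continuous_on {a<..<b} (\<lambda>r. - ln (f (r *\<^sub>R x)))"
    by (rule convex_on_continuous[OF open_greaterThanLessThan])
  from continuous_on_exp[OF continuous_on_minus[OF this]] show ?thesis
    by (rule continuous_on_eq) (use pos in auto)
qed

text \<open>Measurability comes from monotonicity; \<open>max 0 r\<close> discards the negative half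
  of the line, where the function increases instead.\<close>

lemma even_log_concave_ray_measurable:
  assumes "log_concave_fun f" "\<And>x. f (- x) = f x"
  shows "(\<lambda>r. f (max 0 r *\<^sub>R x)) \<in> borel_measurable borel"
proof -
  have "mono (\<lambda>r. - f (max 0 r *\<^sub>R x))"
    by (intro monoI) (auto intro!: even_log_concave_ray_antimono assms)
  then have "(\<lambda>r. - (- f (max 0 r *\<^sub>R x))) \<in> borel_measurable borel"
    by (intro borel_measurable_uminus borel_measurable_mono)
  then show ?thesis by simp
qed

section \<open>Gauge bounds and integrals along the rays\<close>

text \<open>If \<open>x = l *\<^sub>R y\<close> with \<open>norm y \<le> M\<close>, then
  \<open>l\<close> is at least \<open>norm x / M\<close>. Hence the domain of integration at a
  nonzero point is bounded.\<close>

lemma minkowski_functional_pos: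
  assumes "compact K" "x \<noteq> 0"
  shows "0 < minkowski_functional K x"
proof -
  obtain M where M: "0 < M" "\<And>y. y \<in> K \<Longrightarrow> norm y \<le> M"
    using compact_imp_bounded[OF assms(1)] by (auto simp: bounded_pos)
  have "ennreal (norm x / M) \<le> minkowski_functional K x"
    unfolding minkowski_functional_def
  proof (rule INF_greatest)
    fix l assume "l \<in> {l. 0 \<le> l \<and> x \<in> (\<lambda>y. l *\<^sub>R y) ` K}"
    then obtain y where "0 \<le> l" "y \<in> K" "x = l *\<^sub>R y" by auto
    then show "ennreal (norm x / M) \<le> ennreal l"
      using M mult_left_mono[of "norm y" M l] by (intro ennreal_leI) (simp add: field_simps)
  qed
  moreover have "0 < ennreal (norm x / M)" using assms M by simp
  ultimately show ?thesis by (rule less_le_trans[rotated])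
qed

text \<open>This puts the integral into the form that the transport needs. As \<open>f\<close>
  decreases along the ray, the admissible radii with \<open>f\<close> positive form an interval
  starting at \<open>0\<close>, and \<open>R\<close> is its supremum.\<close>

lemma even_log_concave_ray_density:
  fixes f :: "real ^ 'n \<Rightarrow> real"
  assumes lc: "log_concave_fun f" and even: "\<And>x. f (- x) = f x" and k: "1 \<le> k"
    and a: "a \<noteq> \<infinity>"
    and ne: "(\<integral>\<^sup>+r\<in>{r. 0 < r \<and> ennreal r \<le> a}. ennreal (f (r *\<^sub>R x) * r powr (k - 1)) \<partial>lborel) \<noteq> 0"
  shows "\<exists>R>0. (\<forall>r. 0 < r \<longrightarrow> r < R \<longrightarrow> 0 < f (r *\<^sub>R x) \<and> ennreal r \<le> a) \<and>
    (\<lambda>r. f (r *\<^sub>R x) * r powr (k - 1)) integrable_on {0..R} \<and>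
    (\<integral>\<^sup>+r\<in>{r. 0 < r \<and> ennreal r \<le> a}. ennreal (f (r *\<^sub>R x) * r powr (k - 1)) \<partial>lborel)
      = ennreal (integral {0..R} (\<lambda>r. f (r *\<^sub>R x) * r powr (k - 1)))"
proof -
  let ?g = "\<lambda>r. f (r *\<^sub>R x) * r powr (k - 1)"
  let ?I = "\<integral>\<^sup>+r\<in>{r. 0 < r \<and> ennreal r \<le> a}. ennreal (?g r) \<partial>lborel"
  note nn = log_concave_fun_nonneg[OF lc]
  define S where "S = {r. 0 < r \<and> ennreal r \<le> a \<and> 0 < f (r *\<^sub>R x)}"
  obtain M where M: "a = ennreal M" "0 \<le> M" using a by (cases a) auto
  have bdd: "bdd_above S"
    by (rule bdd_aboveI[of _ M]) (auto simp: S_def M ennreal_le_iff)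
  have "S \<noteq> {}"
  proof
    assume S: "S = {}"
    have "f (r *\<^sub>R x) = 0" if "0 < r" "ennreal r \<le> a" for r
      using S that nn[of "r *\<^sub>R x"] unfolding S_def by force
    then have "?I = (\<integral>\<^sup>+r. 0 \<partial>(lborel :: real measure))"
      by (intro nn_integral_cong) (auto split: split_indicator)
    with ne show False by simp
  qed
  define R where "R = Sup S"
  have le: "r \<le> R" if "r \<in> S" for r
    unfolding R_def using that bdd by (rule cSup_upper)
  have R: "0 < R" using \<open>S \<noteq> {}\<close> le by (force simp: S_def)
  have S: "r \<in> S" if r: "0 < r" "r < R" for r
  proof -
    obtain s where s: "s \<in> S" "r < s"
      using less_cSup_iff[OF \<open>S \<noteq> {}\<close> bdd, of r] r(2) unfolding R_def by blast
    then have "ennreal r \<le> a" "0 < f (r *\<^sub>R x)"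
      using r even_log_concave_ray_antimono[OF lc even, of r s x]
        order_trans[OF ennreal_leI[of r s], of a]
      by (auto simp: S_def)
    then show ?thesis using r by (simp add: S_def)
  qed
  \<comment> \<open>Outside the single point \<open>R\<close> this is the integrand extended by
    zero; the value there depends on whether \<open>f\<close> jumps at \<open>R\<close>.\<close>
  define h where "h r = f (max 0 r *\<^sub>R x) * r powr (k - 1) * indicator {0<..<R} r" for r
  have mh: "h \<in> borel_measurable borel"
    unfolding h_def[abs_def] using even_log_concave_ray_measurable[OF lc even] by measurable
  have hnn: "0 \<le> h r" for r unfolding h_def using nn by simp
  have "?I = (\<integral>\<^sup>+r. ennreal (h r) \<partial>lborel)"
  proof (rule nn_integral_cong_AE)
    show "AE r in lborel. ennreal (?g r) * indicator {r. 0 < r \<and> ennreal r \<le> a} r = ennreal (h r)"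
      using AE_lborel_singleton[of R]
    proof eventually_elim
      case (elim r)
      show ?case
      proof (cases "0 < r \<and> r < R")
        case True
        then show ?thesis using S[of r] by (simp add: h_def S_def)
      next
        case False
        then have "r \<notin> S" using le[of r] elim by (auto simp: S_def)
        then have "\<not> (0 < r \<and> ennreal r \<le> a) \<or> f (r *\<^sub>R x) = 0"
          using nn[of "r *\<^sub>R x"] by (auto simp: S_def)
        then show ?thesis using False by (auto simp: h_def split: split_indicator)
      qed
    qed
  qed
  moreover have fin: "(\<integral>\<^sup>+r. ennreal (h r) \<partial>lborel) < \<infinity>"
  proof -
    \<comment> \<open>\<open>f\<close> is largest at the origin, and \<open>1 \<le> k\<close> makes
      the power at most its value at \<open>R\<close>.\<close>
    have "ennreal (h r) \<le> ennreal (f 0 * R powr (k - 1)) * indicator {0..R} r" for r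
      unfolding h_def using k nn even_log_concave_ray_antimono[OF lc even, of 0 r x]
      by (cases "0 < r \<and> r < R") (auto intro!: ennreal_leI mult_mono powr_mono2)
    then have "(\<integral>\<^sup>+r. ennreal (h r) \<partial>lborel)
        \<le> (\<integral>\<^sup>+r. ennreal (f 0 * R powr (k - 1)) * indicator {0..R} r \<partial>lborel)"
      by (rule nn_integral_mono)
    also have "\<dots> < \<infinity>"
      using R by (simp add: nn_integral_cmult_indicator ennreal_mult_less_top)
    finally show ?thesis .
  qed
  ultimately have I: "?I = ennreal (integral UNIV h)"
    using nn_integral_lborel_eq_integral[OF mh hnn fin] by simp
  have "h integrable_on UNIV"
    by (rule nn_integral_integrable_on[OF mh hnn fin])
  then have "(h has_integral integral UNIV h) UNIV"
    by (rule integrable_integral)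
  moreover have "h = (\<lambda>r. if r \<in> {0..R} then h r else 0)"
    by (rule ext) (auto simp: h_def)
  ultimately have "(h has_integral integral UNIV h) {0..R}"
    using has_integral_restrict_UNIV[of "{0..R}" h] by simp
  then have "(?g has_integral integral UNIV h) {0..R}"
    by (rule has_integral_spike[rotated 2, of _ _ _ "{0, R}"]) (auto simp: h_def)
  then have "?g integrable_on {0..R}" "?I = ennreal (integral {0..R} ?g)"
    using I by (auto simp: integral_unique)
  moreover have "\<forall>r. 0 < r \<longrightarrow> r < R \<longrightarrow> 0 < f (r *\<^sub>R x) \<and> ennreal r \<le> a"
    using S by (simp add: S_def)
  ultimately show ?thesis using R by blast
qed

text \<open>The gauges at \<open>x\<close> and \<open>y\<close> are at most \<open>1 / r\<close> and
  \<open>1 / s\<close>, so \<open>p\<close>-subadditivity bounds the gauge at \<open>x + y\<close>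
  by the reciprocal of \<open>pharm p r s\<close>.\<close>

lemma minkowski_functional_pharm:
  fixes K :: "(real ^ 'n) set"
  assumes "0 < p" and K: "compact K" and sub: "p_subadditive p (minkowski_functional K)"
    and r: "0 < r" "ennreal r \<le> inverse (minkowski_functional K x)"
    and s: "0 < s" "ennreal s \<le> inverse (minkowski_functional K y)"
    and xy: "x + y \<noteq> 0"
  shows "ennreal (pharm p r s) \<le> inverse (minkowski_functional K (x + y))"
proof -
  have *: "minkowski_functional K z \<le> ennreal (1 / r)" if "0 < r"
    "ennreal r \<le> inverse (minkowski_functional K z)" for r and z :: "real ^ 'n"
  proof (cases "minkowski_functional K z")
    case (real n)
    show ?thesis
    proof (cases "n = 0")
      case False
      then have "r \<le> inverse n" using that real by (simp add: inverse_ennreal ennreal_le_iff)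
      then show ?thesis using False real that by (simp add: ennreal_leI field_simps)
    qed (use real in simp)
  next
    case top
    then show ?thesis using that by simp
  qed
  obtain a where a: "minkowski_functional K x = ennreal a" "0 \<le> a" "a \<le> 1 / r"
    using *[OF r] r(1) by (cases "minkowski_functional K x") (auto simp: ennreal_le_iff top_unique)
  obtain b where b: "minkowski_functional K y = ennreal b" "0 \<le> b" "b \<le> 1 / s"
    using *[OF s] s(1) by (cases "minkowski_functional K y") (auto simp: ennreal_le_iff top_unique)
  have "ennpowr (minkowski_functional K (x + y)) p \<le> ennreal (a powr p + b powr p)"
    using sub[unfolded p_subadditive_def, rule_format, of x y] a b \<open>0 < p\<close>
    by (simp add: ennpowr_def)
  then obtain c where c: "minkowski_functional K (x + y) = ennreal c" "0 \<le> c"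
      "c powr p \<le> a powr p + b powr p"
    using \<open>0 < p\<close> by (cases "minkowski_functional K (x + y)")
      (auto simp: ennpowr_def top_unique ennreal_le_iff simp flip: ennreal_plus)
  have "0 < c" using minkowski_functional_pos[OF K xy] c by simp
  define t where "t = pharm p r s"
  have t: "0 < t" using pharm_pos r by (simp add: t_def)
  have "c powr p \<le> (1 / r) powr p + (1 / s) powr p"
    using c(3) powr_mono2[of p a "1/r"] powr_mono2[of p b "1/s"] a b \<open>0 < p\<close> by linarith
  also have "\<dots> = t powr (-p)"
    using pharm_powr_minus[of p r s] \<open>0 < p\<close> r by (simp add: t_def powr_divide powr_minus_divide)
  also have "\<dots> = (1 / t) powr p" using t by (simp add: powr_divide powr_minus_divide)
  finally have "c \<le> 1 / t" using \<open>0 < p\<close> t by (intro powr_le_cancel2[of p "1 / t" c]) auto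
  then have "t \<le> inverse c" using \<open>0 < c\<close> t by (simp add: field_simps)
  then show ?thesis using c(1) \<open>0 < c\<close> by (simp add: inverse_ennreal t_def ennreal_leI)
qed

lemma even_log_concave_pharm:
  assumes lc: "log_concave_fun f" and even: "\<And>x. f (- x) = f x"
    and p: "0 < p" "p \<le> 1" and rs: "0 < r" "0 < s"
  shows "f (r *\<^sub>R x) powr ((pharm p r s / r) powr p) * f (s *\<^sub>R y) powr ((pharm p r s / s) powr p)
    \<le> f (pharm p r s *\<^sub>R (x + y))"
proof -
  define t where "t = pharm p r s"
  have t: "0 < t" using pharm_pos rs by (simp add: t_def)
  have sum: "(t / r) powr p + (t / s) powr p = 1"
    unfolding t_def using p rs by (intro pharm_weights) auto
  \<comment> \<open>This is where \<open>p \<le> 1\<close> enters: on \<open>[0, 1]\<close> the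
    power with exponent \<open>p\<close> dominates the identity.\<close>
  have le: "t / q \<le> (t / q) powr p" if "0 < q" "(t / q) powr p \<le> 1" for q
  proof -
    have "t / q \<le> 1"
      by (rule powr_le_cancel2[of p]) (use that p in auto)
    then show ?thesis using powr_mono'[of p 1 "t / q"] t that p by simp
  qed
  have "f (r *\<^sub>R x) powr ((t / r) powr p) * f (s *\<^sub>R y) powr ((t / s) powr p)
     \<le> f ((t / r) *\<^sub>R r *\<^sub>R x + (t / s) *\<^sub>R s *\<^sub>R y)"
    using t rs sum le[of r] le[of s]
      powr_ge_zero[of "t / r" p] powr_ge_zero[of "t / s" p]
    by (intro even_log_concave_subconvex[OF lc even]) auto
  also have "(t / r) *\<^sub>R r *\<^sub>R x + (t / s) *\<^sub>R s *\<^sub>R y = t *\<^sub>R (x + y)"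
    using rs by (simp add: scaleR_right_distrib)
  finally show ?thesis by (simp add: t_def)
qed

section \<open>Reduction of the inequality for \<open>L_functional\<close> to the transport\<close>

theorem theorem8:
  fixes f :: "real ^ 'n \<Rightarrow> real" and K :: "(real ^ 'n) set" and k p :: real
  assumes "log_concave_fun f"
    and "\<And>x. f (- x) = f x"
    and "1 \<le> k"
    and "0 < p" and "p \<le> 1"
    and "p_convex_body p K"
  shows "p_subadditive p (L_functional f k K)"
  unfolding p_subadditive_def
proof (intro allI)
  fix x y :: "real ^ 'n"
  note lc = assms(1,2)
  have K: "compact K" and sub: "p_subadditive p (minkowski_functional K)"
    using assms(6) by (auto simp: p_convex_body_def)
  define D where "D z = {r. 0 < r \<and> ennreal r \<le> inverse (minkowski_functional K z)}" for z
  define J where "J z = (\<integral>\<^sup>+r\<in>D z. ennreal (f (r *\<^sub>R z) * r powr (k - 1)) \<partial>lborel)" for z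
  have L: "L_functional f k K z = (if z = 0 then 0 else ennpowr (J z) (-(1/k)))" for z
    by (simp add: L_functional_def J_def D_def)
  \<comment> \<open>A vanishing integral at a nonzero \<open>x\<close> or \<open>y\<close> makes the
    right-hand side infinite. The other degenerate cases are immediate from the value
    \<open>0\<close> of the functional at the origin.\<close>
  have inf: "ennpowr (ennpowr 0 (-(1/k))) p = \<infinity>"
    using assms by (simp add: ennpowr_def)
  show "ennpowr (L_functional f k K (x + y)) p
      \<le> ennpowr (L_functional f k K x) p + ennpowr (L_functional f k K y) p"
  proof (cases "x = 0 \<or> y = 0 \<or> x + y = 0 \<or> J x = 0 \<or> J y = 0")
    case True
    then consider "x = 0" | "y = 0" | "x + y = 0" | "x \<noteq> 0" "J x = 0" | "y \<noteq> 0" "J y = 0"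
      by blast
    then show ?thesis
      by cases (use inf assms in \<open>auto simp: L ennpowr_def\<close>)
  next
    case False
    then have ne: "x \<noteq> 0" "y \<noteq> 0" "x + y \<noteq> 0" "J x \<noteq> 0" "J y \<noteq> 0" by auto
    have fin: "inverse (minkowski_functional K z) \<noteq> \<infinity>" if "z \<noteq> 0" for z
      using minkowski_functional_pos[OF K that] by (auto simp: infinity_ennreal_def)
    obtain R where R: "0 < R" "\<And>r. 0 < r \<Longrightarrow> r < R \<Longrightarrow> 0 < f (r *\<^sub>R x)"
      "\<And>r. 0 < r \<Longrightarrow> r < R \<Longrightarrow> ennreal r \<le> inverse (minkowski_functional K x)"
      "(\<lambda>r. f (r *\<^sub>R x) * r powr (k - 1)) integrable_on {0..R}"
      "J x = ennreal (integral {0..R} (\<lambda>r. f (r *\<^sub>R x) * r powr (k - 1)))"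
      using even_log_concave_ray_density[OF lc assms(3) fin[OF ne(1)] ne(4)[unfolded J_def D_def]]
      unfolding J_def D_def by blast
    obtain S where S: "0 < S" "\<And>r. 0 < r \<Longrightarrow> r < S \<Longrightarrow> 0 < f (r *\<^sub>R y)"
      "\<And>r. 0 < r \<Longrightarrow> r < S \<Longrightarrow> ennreal r \<le> inverse (minkowski_functional K y)"
      "(\<lambda>r. f (r *\<^sub>R y) * r powr (k - 1)) integrable_on {0..S}"
      "J y = ennreal (integral {0..S} (\<lambda>r. f (r *\<^sub>R y) * r powr (k - 1)))"
      using even_log_concave_ray_density[OF lc assms(3) fin[OF ne(2)] ne(5)[unfolded J_def D_def]]
      unfolding J_def D_def by blast
    define A where "A = integral {0..R} (\<lambda>r. f (r *\<^sub>R x) * r powr (k - 1))"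
    define B where "B = integral {0..S} (\<lambda>r. f (r *\<^sub>R y) * r powr (k - 1))"
    \<comment> \<open>The indicator cuts \<open>f\<close> on the third ray to the domain of
      \<open>x + y\<close>, so that the integral of \<open>w\<close> over the half-line is
      \<open>J (x + y)\<close>.\<close>
    define w where "w t = f (max 0 t *\<^sub>R (x + y)) * indicator (D (x + y)) t" for t
    have "D (x + y) \<in> sets borel" unfolding D_def by measurable
    then have mw: "w \<in> borel_measurable borel"
      unfolding w_def[abs_def] using even_log_concave_ray_measurable[OF lc] by measurable
    have w: "f (r *\<^sub>R x) powr ((pharm p r s / r) powr p) * f (s *\<^sub>R y) powr ((pharm p r s / s) powr p)
        \<le> w (pharm p r s)" if "0 < r" "r < R" "0 < s" "s < S" for r s
    proof -
      have "pharm p r s \<in> D (x + y)"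
        using minkowski_functional_pharm[OF assms(4) K sub that(1) R(3)[OF that(1,2)] that(3) S(3)[OF that(3,4)] ne(3)]
          pharm_pos[OF that(1)] by (simp add: D_def)
      then show ?thesis
        using even_log_concave_pharm[OF lc assms(4,5) that(1,3), of x y] pharm_pos[OF that(1), of p s]
        by (simp add: w_def)
    qed
    \<comment> \<open>Chosen so that \<open>c powr (-p/k)\<close> is the right-hand side of the
      claim; the power \<open>-p/k\<close> is decreasing, so \<open>c \<le> J (x + y)\<close>
      suffices.\<close>
    define c where "c = (A powr (-p/k) + B powr (-p/k)) powr (-k/p)"
    have "0 < k" using assms(3) by simp
    note transport = integral_pharm_transport[OF assms(4) this R(1) S(1)
        log_concave_ray_continuous_on[OF lc(1) R(2)] log_concave_ray_continuous_on[OF lc(1) S(2)]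
        R(2) S(2) R(4) S(4) mw w, folded A_def B_def]
    note AB = transport(1,2)
    have "ennreal c \<le> (\<integral>\<^sup>+t\<in>{0<..}. ennreal (w t * t powr (k - 1)) \<partial>lborel)"
      unfolding c_def by (rule transport(3))
    also have "\<dots> = J (x + y)"
      unfolding J_def by (intro nn_integral_cong) (auto simp: w_def D_def split: split_indicator)
    finally have cJ: "ennreal c \<le> J (x + y)" .
    have AB': "0 < A powr (-p/k) + B powr (-p/k)" using AB by (intro add_pos_pos) auto
    then have c: "0 < c" by (simp add: c_def)
    have cpk: "c powr (-p/k) = A powr (-p/k) + B powr (-p/k)"
      using AB' assms by (simp add: c_def powr_powr)
    have pow: "ennpowr (ennpowr (ennreal z) (-(1/k))) p = ennreal (z powr (-p/k))" if "0 < z" for z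
      using that assms by (auto simp: ennpowr_def powr_powr)
    have "ennpowr (ennpowr (J (x + y)) (-(1/k))) p \<le> ennreal (c powr (-p/k))"
    proof (cases "J (x + y)")
      case (real z)
      then have "c \<le> z" using cJ by (simp add: ennreal_le_iff)
      then show ?thesis
        using real pow[of z] c assms by (auto intro!: ennreal_leI powr_mono2')
    next
      case top
      then show ?thesis using assms by (simp add: ennpowr_def)
    qed
    also have "\<dots> = ennreal (A powr (-p/k)) + ennreal (B powr (-p/k))"
      unfolding cpk by simp
    finally show ?thesis
      using ne R(5) S(5) AB pow[of A] pow[of B] by (simp add: L flip: A_def B_def)
  qed
qed

end
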